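(* Let $Q$ be a prime power, let $\alpha\in\mathbb{F}_Q^*$, and put $q=Q^m$, where $m$ and $s$ are positive integers with $\gcd(m,Q-1)=1$. Then $f(x):=\alpha x^{1+s(q-1)/(Q-1)}$ is a complete permutation polynomial over $\mathbb{F}_q$ if and only if both of the following hold: (1) $\gcd\bigl(1+s(q-1)/(Q-1),\,Q-1\bigr)=1$; and (2) $\alpha x^{ms+1}+x$ permutes $\mathbb{F}_Q$.
   Context: For a prime power $Q$, $\mathbb{F}_Q$ denotes the finite field with $Q$ elements, regarded as a subfield of $\mathbb{F}_{Q^m}$. A polynomial $f(x)$ permutes a finite field $\mathbb{F}$ (is a permutation polynomial over $\mathbb{F}$) if $\alpha\mapsto f(\alpha)$ is a bijection from $\mathbb{F}$ to itself. A complete permutation polynomial over $\mathbb{F}_q$ is a polynomial $f(x)\in\mathbb{F}_q[x]$ such that both $f(x)$ and $f(x)+x$ are permutation polynomials over $\mathbb{F}_q$. *)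

theory Defs
  imports
    "HOL-Algebra.Algebraic_Closure_Type"
    "HOL-Number_Theory.Prime_Powers"
    "HOL-Computational_Algebra.Polynomial"
begin

definition permutation_poly_over :: "'a::comm_semiring_0 set \<Rightarrow> 'a poly \<Rightarrow> bool" where
  "permutation_poly_over F f \<longleftrightarrow> bij_betw (poly f) F F"

(* [:0, 1:] is the polynomial x. *)
definition complete_permutation_poly_over :: "'a::comm_semiring_1 set \<Rightarrow> 'a poly \<Rightarrow> bool" where
  "complete_permutation_poly_over F f \<longleftrightarrow>
     set (coeffs f) \<subseteq> F \<and>
     permutation_poly_over F f \<and>
     permutation_poly_over F (f + [:0, 1:])"

(* HOL-Algebra's notion of subfield, transferred along ring_of_type_algebra to a type of
   class field. *)
abbreviation type_subfield :: "'a::field set \<Rightarrow> bool" where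
  "type_subfield K \<equiv> subfield K (ring_of_type_algebra :: 'a ring)"

end

theory Submission
  imports Defs "HOL-Number_Theory.Cong"
begin

text \<open>
  Put \<open>N = (q - 1)/(Q - 1)\<close>, so that \<open>x \<mapsto> x^N\<close> is the norm from the field with \<open>q\<close> elements
  to its subfield \<open>K\<close> with \<open>Q\<close> elements; on \<open>K\<close> it is the map \<open>t \<mapsto> t^m\<close>, which is a bijection
  of \<open>K\<close> since \<open>m\<close> is coprime to \<open>Q - 1\<close>. The polynomial \<open>f(x) + x\<close> has the form \<open>x h(x^N)\<close> with
  \<open>h(t) = \<alpha> t^s + 1\<close> preserving \<open>K\<close>. Taking norms shows that it permutes the big field iff
  \<open>t h(t)^m\<close> permutes \<open>K\<close>, and after substituting \<open>t = u^m\<close> the latter is the \<open>m\<close>-th power of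
  \<open>\<alpha> u^(ms + 1) + u\<close>. The monomial \<open>f\<close> itself permutes iff its exponent \<open>1 + s N\<close> is coprime to
  \<open>q - 1 = N (Q - 1)\<close>, and it is always coprime to \<open>N\<close>.
\<close>

text \<open>Multiplication by \<open>t\<close> permutes the nonzero elements, so their product can
  be cancelled from itself times a power of \<open>t\<close>. Stating this for a multiplicatively
  closed set serves both the subfield and the whole field.\<close>

lemma power_card_nonzero_eq_1:
  fixes K :: "'a::idom set"
  assumes "finite K" and closed: "\<And>x y. x \<in> K \<Longrightarrow> y \<in> K \<Longrightarrow> x * y \<in> K"
    and t: "t \<in> K - {0}"
  shows "t ^ card (K - {0}) = 1"
proof -
  let ?K = "K - {0}"
  have inj: "inj_on ((*) t) ?K"
    using t by (auto intro: inj_onI)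
  have "(*) t ` ?K \<subseteq> ?K"
    using t closed by auto
  then have "(*) t ` ?K = ?K"
    using inj \<open>finite K\<close> by (simp add: endo_inj_surj)
  then have "\<Prod>?K = prod ((*) t) ?K"
    using prod.reindex[OF inj, of "\<lambda>x. x"] by (simp add: comp_def)
  also have "\<dots> = t ^ card ?K * \<Prod>?K"
    by (simp add: prod.distrib)
  finally show ?thesis
    using \<open>finite K\<close> by simp
qed

lemma power_card_eq_self:
  fixes K :: "'a::idom set"
  assumes "finite K" "\<And>x y. x \<in> K \<Longrightarrow> y \<in> K \<Longrightarrow> x * y \<in> K" "0 \<in> K" "t \<in> K"
  shows "t ^ card K = t"
proof (cases "t = 0")
  case True
  then show ?thesis
    using assms by (auto simp: card_gt_0_iff intro!: zero_power)
next
  case False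
  have "card K = Suc (card (K - {0}))"
    using assms by (metis card_Suc_Diff1)
  with False show ?thesis
    using power_card_nonzero_eq_1[OF assms(1,2), of t] assms(4) by simp
qed

lemma card_power_eq_1_le:
  fixes n :: nat
  assumes "n > 0"
  shows "card {x::'a::idom. x ^ n = 1} \<le> n"
proof -
  let ?p = "Polynomial.monom (1::'a) n + [:-1:]"
  have "degree ?p = n"
    using assms by (subst degree_add_eq_left) (auto simp: degree_monom_eq)
  moreover from this have "?p \<noteq> 0"
    using assms by auto
  ultimately show ?thesis
    using card_poly_roots_bound[of ?p] by (simp add: poly_monom)
qed

text \<open>Later identifies \<open>K\<close> with the fixed points of \<open>x ^ Q\<close>.\<close>

lemma card_power_eq_self_le:
  fixes n :: nat
  assumes "n > 1"
  shows "finite {x::'a::idom. x ^ n = x}" "card {x::'a::idom. x ^ n = x} \<le> n"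
proof -
  let ?p = "Polynomial.monom (1::'a) n + [:0, -1:]"
  have "degree ?p = n"
    using assms by (subst degree_add_eq_left) (auto simp: degree_monom_eq)
  moreover from this have "?p \<noteq> 0"
    using assms by auto
  ultimately show "finite {x::'a. x ^ n = x}" "card {x::'a. x ^ n = x} \<le> n"
    using card_poly_roots_bound[of ?p] poly_roots_finite[of ?p] by (simp_all add: poly_monom)
qed

lemma coprime_power_inj:
  fixes x y :: "'a::monoid_mult"
  assumes "coprime k n" "x ^ n = 1" "y ^ n = 1" "x ^ k = y ^ k"
  shows "x = y"
proof -
  obtain b where "[k * b = Suc 0] (mod n)"
    using cong_solve_coprime_nat[OF assms(1)] by auto
  \<comment> \<open>Writing the congruence additively keeps all exponents natural, as a monoid has
    no inverses; the multiples of \<open>n\<close> vanish on \<open>n\<close>-th roots of unity, so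
    the \<open>b\<close>-th power undoes the \<open>k\<close>-th.\<close>
  then obtain u v where eq: "k * b + n * u = Suc 0 + n * v"
    by (metis cong_iff_lin_nat mult.commute)
  have "z = (z ^ k) ^ b" if "z ^ n = 1" for z :: 'a
    using arg_cong[OF eq, of "\<lambda>e. z ^ e"] that by (simp add: power_add power_mult)
  then show ?thesis
    using assms by metis
qed

lemma bij_power_subset:
  fixes K :: "'a::idom set"
  assumes "finite K" and closed: "\<And>x y. x \<in> K \<Longrightarrow> y \<in> K \<Longrightarrow> x * y \<in> K"
    and "0 \<in> K" "1 \<in> K" "k > 0" "coprime k (card K - 1)"
  shows "bij_betw (\<lambda>x. x ^ k) K K"
proof -
  have "x ^ j \<in> K" if "x \<in> K" for x j
    using that closed \<open>1 \<in> K\<close> by (induction j) auto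
  moreover have "inj_on (\<lambda>x. x ^ k) K"
  proof (rule inj_onI)
    fix x y assume xy: "x \<in> K" "y \<in> K" "x ^ k = y ^ k"
    show "x = y"
    proof (cases "x = 0 \<or> y = 0")
      case True
      then show ?thesis
        using xy \<open>k > 0\<close> by (metis power_eq_0_iff)
    next
      case False
      have "x ^ (card K - 1) = 1" "y ^ (card K - 1) = 1"
        using power_card_nonzero_eq_1[OF assms(1,2)] xy False \<open>0 \<in> K\<close> by auto
      then show ?thesis
        using coprime_power_inj assms(6) xy(3) by blast
    qed
  qed
  ultimately show ?thesis
    using \<open>finite K\<close> by (simp add: bij_betw_def endo_inj_surj image_subset_iff)
qed

text \<open>
  If \<open>d\<close> divides both \<open>k\<close> and \<open>|F| - 1\<close> and \<open>x \<mapsto> x^k\<close> is onto, then all \<open>|F| - 1\<close> nonzero elements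
  are roots of \<open>x^((|F| - 1)/d) - 1\<close>.
\<close>
lemma bij_power_iff_coprime:
  assumes "k > 0"
  shows "bij (\<lambda>x::'a::finite_field. x ^ k) \<longleftrightarrow> coprime k (card (UNIV :: 'a set) - 1)"
proof
  let ?n = "card (UNIV :: 'a set) - 1"
  assume bij: "bij (\<lambda>x::'a. x ^ k)"
  have cardn: "card (UNIV - {0::'a}) = ?n"
    by simp
  have "card {0::'a, 1} \<le> card (UNIV :: 'a set)"
    by (intro card_mono) auto
  then have npos: "?n > 0"
    by simp
  show "coprime k ?n"
  proof (rule coprimeI)
    fix d assume "d dvd k" "d dvd ?n"
    then obtain a b where a: "k = d * a" and b: "?n = d * b"
      by (auto elim!: dvdE)
    have "y ^ b = 1" if "y \<noteq> 0" for y :: 'a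
    proof -
      obtain x where x: "y = x ^ k"
        using bij by (metis bij_pointE)
      with that \<open>k > 0\<close> have "x \<noteq> 0"
        by auto
      have "y ^ b = (x ^ ?n) ^ a"
        unfolding x a b by (simp add: mult_ac flip: power_mult)
      with \<open>x \<noteq> 0\<close> show ?thesis
        using power_card_nonzero_eq_1[of UNIV x] cardn by simp
    qed
    then have "UNIV - {0} \<subseteq> {y::'a. y ^ b = 1}"
      by auto
    then have "?n \<le> card {y::'a. y ^ b = 1}"
      using cardn by (metis card_mono finite)
    also have "\<dots> \<le> b"
      using npos b by (intro card_power_eq_1_le) (auto intro: gr0I)
    finally have "d * b \<le> 1 * b" "b > 0"
      using npos b by (auto intro: gr0I)
    then have "d \<le> 1"
      by (metis mult_le_cancel2)
    moreover have "d \<noteq> 0"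
      using npos b by (metis mult_zero_left less_irrefl)
    ultimately show "is_unit d"
      by simp
  qed
next
  assume "coprime k (card (UNIV :: 'a set) - 1)"
  then show "bij (\<lambda>x::'a. x ^ k)"
    using assms by (intro bij_power_subset) auto
qed

text \<open>The map \<open>x ^ N\<close> intertwines \<open>?F\<close> with \<open>?g\<close>.
  Surjectivity descends to \<open>K\<close>; conversely, injectivity of \<open>?g\<close> gives
  points with equal \<open>?F\<close>-values the same norm, hence the same factor \<open>h\<close>,
  which can be cancelled unless it is zero.\<close>

lemma norm_twist_bij_iff:
  fixes K :: "'a::finite_field set"
  assumes norm: "range (\<lambda>x. x ^ N) = K" and "N > 0"
    and h: "\<And>t. t \<in> K \<Longrightarrow> h t \<in> K"
    and closed: "\<And>x y. x \<in> K \<Longrightarrow> y \<in> K \<Longrightarrow> x * y \<in> K"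
  shows "bij (\<lambda>x. x * h (x ^ N)) \<longleftrightarrow> bij_betw (\<lambda>t. t * h t ^ N) K K"
    (is "bij ?F \<longleftrightarrow> bij_betw ?g K K")
proof
  have commute: "?F x ^ N = ?g (x ^ N)" for x
    by (simp add: power_mult_distrib)
  {
    assume "bij ?F"
    have "?g ` K = (\<lambda>x. ?F x ^ N) ` UNIV"
      unfolding commute by (subst norm[symmetric]) (simp only: image_image)
    also have "\<dots> = (\<lambda>x. x ^ N) ` range ?F"
      by (simp only: image_image)
    also have "\<dots> = K"
      using \<open>bij ?F\<close> norm by (simp only: bij_is_surj)
    finally show "bij_betw ?g K K"
      by (simp add: bij_betw_def eq_card_imp_inj_on)
  next
    assume g: "bij_betw ?g K K"
    have "inj ?F"
    proof (rule injI)
      fix x y assume eq: "?F x = ?F y"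
      have "?g (x ^ N) = ?g (y ^ N)"
        using eq commute by metis
      moreover have K: "x ^ N \<in> K" "y ^ N \<in> K" "0 ^ N \<in> K"
        using norm by blast+
      ultimately have xy: "x ^ N = y ^ N"
        using g by (auto simp: bij_betw_def dest: inj_onD)
      show "x = y"
      proof (cases "h (x ^ N) = 0")
        \<comment> \<open>A zero of \<open>h\<close> gives \<open>?g\<close> the value it takes at
          \<open>0\<close>, which forces \<open>x ^ N = 0\<close> and so
          \<open>x = y = 0\<close>.\<close>
        case True
        then have "?g (x ^ N) = ?g (0 ^ N)"
          using \<open>N > 0\<close> by (simp add: zero_power)
        then have "x ^ N = 0 ^ N"
          using g K unfolding bij_betw_def by (blast dest: inj_onD)
        then show ?thesis
          using xy \<open>N > 0\<close> by (metis power_eq_0_iff zero_power)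
      next
        case False
        then show ?thesis
          using eq xy by simp
      qed
    qed
    then show "bij ?F"
      by (simp add: bij_def finite_UNIV_inj_surj)
  }
qed

lemma type_subfield_closed:
  fixes K :: "'a::field set"
  assumes "type_subfield K"
  shows "0 \<in> K" "1 \<in> K" "x \<in> K \<Longrightarrow> y \<in> K \<Longrightarrow> x + y \<in> K" "x \<in> K \<Longrightarrow> y \<in> K \<Longrightarrow> x * y \<in> K"
proof -
  have "subcring K (ring_of_type_algebra :: 'a ring)"
    using assms by (intro subdomain.axioms(1) subfield.axioms(1))
  from subcringE[OF this]
  show "0 \<in> K" "1 \<in> K" "x \<in> K \<Longrightarrow> y \<in> K \<Longrightarrow> x + y \<in> K" "x \<in> K \<Longrightarrow> y \<in> K \<Longrightarrow> x * y \<in> K"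
    by (simp_all add: ring_of_type_algebra_def)
qed

theorem corollary3p1:
  fixes Q q m s :: nat and K :: "'a::finite_field set" and \<alpha> :: 'a
  assumes "primepow Q"
    and "m > 0" and "s > 0"
    and "gcd m (Q - 1) = 1"
    and "q = Q ^ m"
    and "card (UNIV :: 'a set) = q"
    and "type_subfield K" and "card K = Q"
    and "\<alpha> \<in> K - {0}"
  shows "complete_permutation_poly_over UNIV
           (Polynomial.monom \<alpha> (1 + s * ((q - 1) div (Q - 1))))
     \<longleftrightarrow> gcd (1 + s * ((q - 1) div (Q - 1))) (Q - 1) = 1
       \<and> permutation_poly_over K (Polynomial.monom \<alpha> (m * s + 1) + [:0, 1:])"
proof -
  define N where "N = (q - 1) div (Q - 1)"
  have Q1: "Q > 1"
    using assms(1) primepow_gt_Suc_0 by force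
  have K: "0 \<in> K" "1 \<in> K" "\<And>x y. x \<in> K \<Longrightarrow> y \<in> K \<Longrightarrow> x + y \<in> K"
    "\<And>x y. x \<in> K \<Longrightarrow> y \<in> K \<Longrightarrow> x * y \<in> K"
    using type_subfield_closed[OF assms(7)] by blast+
  have Kpow: "t ^ j \<in> K" if "t \<in> K" for t j
    using that K by (induction j) auto
  have \<alpha>: "\<alpha> \<in> K" "\<alpha> \<noteq> 0"
    using assms(9) by auto
  \<comment> \<open>The geometric sum shows that the division defining \<open>N\<close> is
    exact.\<close>
  have "Q ^ j - 1 = (Q - 1) * (\<Sum>i<j. Q ^ i)" for j
  proof (induction j)
    case (Suc j)
    have "Q ^ Suc j - 1 = (Q - 1) * Q ^ j + (Q ^ j - 1)"
      using Q1 by (simp add: diff_mult_distrib)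
    with Suc show ?case
      by (simp add: distrib_left)
  qed simp
  then have qN: "q - 1 = (Q - 1) * N" and N: "N = (\<Sum>i<m. Q ^ i)"
    using Q1 by (simp_all add: N_def assms(5))
  have "N \<ge> Q ^ 0"
    unfolding N using \<open>m > 0\<close> by (intro member_le_sum) auto
  then have "N > 0"
    by simp

  \<comment> \<open>Frobenius and the norm onto \<open>K\<close>\<close>
  have frob: "t ^ Q = t" if "t \<in> K" for t
    using power_card_eq_self[of K t] K that assms(8) by simp
  then have "t ^ (Q ^ i) = t" if "t \<in> K" for t i
    using that by (induction i) (simp_all add: power_mult)
  \<comment> \<open>Each of the \<open>m\<close> summands \<open>Q ^ i\<close> of \<open>N\<close>
    contributes one factor \<open>t\<close>.\<close>
  then have normK: "t ^ N = t ^ m" if "t \<in> K" for t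
    using that by (simp add: N power_sum)
  have bijm: "bij_betw (\<lambda>t. t ^ m) K K"
    using K assms(2,4,8) by (intro bij_power_subset) (auto simp: coprime_iff_gcd_eq_1)
  \<comment> \<open>\<open>K\<close> already supplies \<open>Q\<close> roots of
    \<open>x ^ Q = x\<close>, the maximal number, so membership in \<open>K\<close> becomes an
    equation.\<close>
  have fixed: "K = {x. x ^ Q = x}"
    using card_power_eq_self_le[OF Q1, where 'a = 'a] frob assms(8)
    by (intro card_seteq) auto
  have "x ^ N \<in> K" for x
  proof -
    have "N * Q = (q - 1) + N"
      using Q1 qN by (simp add: algebra_simps diff_mult_distrib2)
    then have "(x ^ N) ^ Q = x ^ (q - 1) * x ^ N"
      by (simp flip: power_mult power_add)
    also have "\<dots> = x ^ N"
      using power_card_nonzero_eq_1[of UNIV x] \<open>N > 0\<close> assms(6) by (cases "x = 0") auto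
    finally show ?thesis
      unfolding fixed by simp
  qed
  \<comment> \<open>Norms of elements of \<open>K\<close> already fill \<open>K\<close>, because
    there the norm is the bijection \<open>t ^ m\<close>.\<close>
  moreover have "K = (\<lambda>t. t ^ N) ` K"
    using bijm by (auto simp: bij_betw_def normK cong: image_cong)
  ultimately have norm: "range (\<lambda>x. x ^ N) = K"
    by blast

  \<comment> \<open>The monomial and condition (1)\<close>
  have "bij (\<lambda>x. \<alpha> * x ^ (1 + s * N)) \<longleftrightarrow> bij (\<lambda>x::'a. x ^ (1 + s * N))"
  proof -
    have "bij ((*) \<alpha>)"
      using \<alpha> by (intro bij_betwI[where g = "\<lambda>x. x / \<alpha>"]) auto
    then show ?thesis
      using bij_betw_comp_iff2[of "(*) \<alpha>" UNIV UNIV "\<lambda>x::'a. x ^ (1 + s * N)" UNIV]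
      by (simp add: comp_def)
  qed
  also have "\<dots> \<longleftrightarrow> coprime (1 + s * N) ((Q - 1) * N)"
    using bij_power_iff_coprime[of "1 + s * N", where 'a = 'a] assms(6) qN by simp
  also have "\<dots> \<longleftrightarrow> gcd (1 + s * N) (Q - 1) = 1"
  proof -
    have "coprime (1 + s * N) N"
      by (metis coprime_1_left coprime_iff_gcd_eq_1 gcd_add_mult gcd.commute add.commute mult.commute)
    then show ?thesis
      by (simp add: coprime_iff_gcd_eq_1[symmetric] del: One_nat_def)
  qed
  finally have first:
    "bij (\<lambda>x. \<alpha> * x ^ (1 + s * N)) \<longleftrightarrow> gcd (1 + s * N) (Q - 1) = 1" .

  \<comment> \<open>The sum with \<open>x\<close> and condition (2)\<close>
  define h where "h t = \<alpha> * t ^ s + 1" for t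
  have hK: "h t \<in> K" if "t \<in> K" for t
    using that K Kpow \<alpha> by (simp add: h_def)
  define p where "p u = \<alpha> * u ^ (m * s + 1) + u" for u
  have pK: "p ` K \<subseteq> K"
    using K Kpow \<alpha> by (auto simp: p_def simp del: power_Suc)
  have "bij (\<lambda>x. \<alpha> * x ^ (1 + s * N) + x) \<longleftrightarrow> bij (\<lambda>x. x * h (x ^ N))"
    by (simp add: h_def distrib_left power_mult mult_ac)
  also have "\<dots> \<longleftrightarrow> bij_betw (\<lambda>t. t * h t ^ N) K K"
    by (rule norm_twist_bij_iff[OF norm \<open>N > 0\<close> hK K(4)])
  also have "\<dots> \<longleftrightarrow> bij_betw (\<lambda>t. t * h t ^ m) K K"
    using hK normK by (intro bij_betw_cong) auto
  also have "\<dots> \<longleftrightarrow> bij_betw (\<lambda>u. p u ^ m) K K"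
  proof -
    have "p u = u * h (u ^ m)" for u
      by (simp add: p_def h_def power_mult distrib_left)
    then have "p u ^ m = u ^ m * h (u ^ m) ^ m" for u
      by (simp add: power_mult_distrib)
    then show ?thesis
      using bij_betw_comp_iff[OF bijm, of "\<lambda>t. t * h t ^ m" K] by (simp add: comp_def)
  qed
  \<comment> \<open>Since \<open>p\<close> maps \<open>K\<close> into itself, the outer
    \<open>m\<close>-th power, a bijection of \<open>K\<close>, can be stripped.\<close>
  also have "\<dots> \<longleftrightarrow> bij_betw p K K"
    using bij_betw_comp_iff2[OF bijm pK] by (simp add: comp_def)
  finally have second: "bij (\<lambda>x. \<alpha> * x ^ (1 + s * N) + x) \<longleftrightarrow> bij_betw p K K" .

  have "poly (Polynomial.monom \<alpha> k) = (\<lambda>x. \<alpha> * x ^ k)"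
    "poly (Polynomial.monom \<alpha> k + [:0, 1:]) = (\<lambda>x. \<alpha> * x ^ k + x)" for k
    by (auto simp: poly_monom)
  then show ?thesis
    using first second
    by (simp add: complete_permutation_poly_over_def permutation_poly_over_def p_def[abs_def] N_def
        del: poly_add power_Suc)
qed

end
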